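(* Let $k\ge 2$ be an integer. If both graphs $G$ and $H$ admit a neighborhood-balanced $k$-coloring, then so does the cartesian product $G\,\square\,H$.
   Context: All graphs are finite, simple and undirected. A neighborhood-balanced $k$-coloring of a graph is a (not necessarily proper) vertex coloring with colors $1,\dots,k$ such that every vertex has the same number of neighbors of each of the $k$ colors. The cartesian product $G\,\square\,H$ has vertex set $V(G)\times V(H)$, and $(u,v)$ and $(u',v')$ are adjacent if and only if $u=u'$ and $vv'\in E(H)$, or $v=v'$ and $uu'\in E(G)$. *)

theory Defs
  imports "Graph_Theory.Pair_Digraph"
begin

text \<open>
  A finite simple undirected graph is a \<^locale>\<open>pair_graph\<close>: an undirected edge between
  \<open>u\<close> and \<open>v\<close> is represented by the two arcs \<open>(u, v)\<close> and \<open>(v, u)\<close>.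
\<close>

definition neighbors :: "'a pair_pre_digraph \<Rightarrow> 'a \<Rightarrow> 'a set" where
  "neighbors G v = {w. (v, w) \<in> parcs G}"

definition neighborhood_balanced_coloring ::
    "nat \<Rightarrow> 'a pair_pre_digraph \<Rightarrow> ('a \<Rightarrow> nat) \<Rightarrow> bool" where
  "neighborhood_balanced_coloring k G c \<longleftrightarrow>
     c ` pverts G \<subseteq> {1..k} \<and>
     (\<forall>v \<in> pverts G. \<forall>i \<in> {1..k}. \<forall>j \<in> {1..k}.
        card {w \<in> neighbors G v. c w = i} = card {w \<in> neighbors G v. c w = j})"

definition admits_neighborhood_balanced_coloring :: "nat \<Rightarrow> 'a pair_pre_digraph \<Rightarrow> bool" where
  "admits_neighborhood_balanced_coloring k G \<longleftrightarrow>
     (\<exists>c. neighborhood_balanced_coloring k G c)"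

definition cartesian_product ::
    "'a pair_pre_digraph \<Rightarrow> 'b pair_pre_digraph \<Rightarrow> ('a \<times> 'b) pair_pre_digraph" where
  "cartesian_product G H =
     \<lparr> pverts = pverts G \<times> pverts H,
       parcs = {((u, v), (u', v')) | u v u' v'.
         (u, v) \<in> pverts G \<times> pverts H \<and> (u', v') \<in> pverts G \<times> pverts H \<and>
         (u = u' \<and> (v, v') \<in> parcs H \<or> v = v' \<and> (u, u') \<in> parcs G)} \<rparr>"

lemma pair_graph_cartesian_product:
  assumes "pair_graph G" and "pair_graph H"
  shows "pair_graph (cartesian_product G H)"
proof -
  interpret G: pair_graph G by fact
  interpret H: pair_graph H by fact
  let ?P = "cartesian_product G H"
  have sub: "parcs ?P \<subseteq> pverts ?P \<times> pverts ?P"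
    by (auto simp: cartesian_product_def)
  have fin: "finite (pverts ?P)"
    using G.pair_finite_verts H.pair_finite_verts by (simp add: cartesian_product_def)
  show ?thesis
  proof
    show "finite (parcs ?P)"
      using sub fin by (meson finite_SigmaI finite_subset)
    show "symmetric (with_proj ?P)"
      unfolding symmetric_def sym_def
      by (auto simp: cartesian_product_def dest: G.arcs_symmetric H.arcs_symmetric)
    show "fst e \<noteq> snd e" if "e \<in> parcs ?P" for e
      using that by (auto simp: cartesian_product_def dest: G.no_loops' H.no_loops')
  qed (use sub fin in auto)
qed

end

theory Submission
  imports Defs
begin

text \<open>
  Read the colors as residues modulo \<open>k\<close> and color the vertex \<open>(u, v)\<close> of the product by the
  residue of \<open>a u + b v\<close>, where \<open>a\<close> and \<open>b\<close> are balanced colorings of the two factors. The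
  neighbors of \<open>(u, v)\<close> form two disjoint families: the vertices \<open>(u, v')\<close> with \<open>v'\<close> adjacent to
  \<open>v\<close>, and the vertices \<open>(u', v)\<close> with \<open>u'\<close> adjacent to \<open>u\<close>. Within the first family the colors
  are those of the neighbors of \<open>v\<close>, all translated by the constant \<open>a u\<close>; a translation permutes
  the residues, so each color still occurs equally often
  (\<open>balanced_neighbors_translated_coloring\<close>). The same holds for the second family with the
  constant \<open>b v\<close>, and adding the two counts shows that the product coloring is balanced.
\<close>

lemma bij_betw_cyclic_translation:
  fixes k s :: nat
  assumes "k > 0"
  shows "bij_betw (\<lambda>x. (s + x) mod k + 1) {1..k} {1..k}"
proof -
  have le: "x = y" if "x \<le> y" "x \<in> {1..k}" "y \<in> {1..k}" "(s + x) mod k = (s + y) mod k" for x y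
  proof -
    have "k dvd y - x"
      using that mod_eq_dvd_iff_nat[of "s + x" "s + y" k] by simp
    moreover have "y - x < k"
      using that by auto
    ultimately show ?thesis
      using that(1) by (auto dest: nat_dvd_not_less)
  qed
  have inj: "inj_on (\<lambda>x. (s + x) mod k + 1) {1..k}"
  proof (rule inj_onI)
    fix x y
    assume "x \<in> {1..k}" "y \<in> {1..k}" "(s + x) mod k + 1 = (s + y) mod k + 1"
    then show "x = y"
      using le[of x y] le[of y x] by (cases "x \<le> y") auto
  qed
  have "(\<lambda>x. (s + x) mod k + 1) ` {1..k} \<subseteq> {1..k}"
    using assms by (auto simp: Suc_le_eq)
  then show ?thesis
    using inj by (simp add: bij_betw_def endo_inj_surj)
qed

text \<open>
  Each color class of the translated coloring on the neighborhood is a color class of the original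
  coloring, because exactly one color is translated to a given one.
\<close>

lemma balanced_neighbors_translated_coloring:
  assumes "pair_graph G" and c: "neighborhood_balanced_coloring k G c" and "k > 0"
    and v: "v \<in> pverts G" and ij: "i \<in> {1..k}" "j \<in> {1..k}"
  shows "card {w \<in> neighbors G v. (s + c w) mod k + 1 = i} =
         card {w \<in> neighbors G v. (s + c w) mod k + 1 = j}"
proof -
  interpret pair_graph G by fact
  have color: "c w \<in> {1..k}" if "w \<in> neighbors G v" for w
    using that c in_arcsD2[of v w]
    by (auto simp: neighbors_def neighborhood_balanced_coloring_def)
  note bij = bij_betw_cyclic_translation[OF \<open>k > 0\<close>, of s]
  have color_class: "\<exists>m \<in> {1..k}. {w \<in> neighbors G v. (s + c w) mod k + 1 = l} =
                            {w \<in> neighbors G v. c w = m}"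
    if l: "l \<in> {1..k}" for l
  proof -
    have "l \<in> (\<lambda>x. (s + x) mod k + 1) ` {1..k}"
      using l bij_betw_imp_surj_on[OF bij] by simp
    then obtain m where m: "m \<in> {1..k}" "(s + m) mod k + 1 = l"
      by blast
    have "(s + c w) mod k + 1 = l \<longleftrightarrow> c w = m" if "w \<in> neighbors G v" for w
      using inj_on_eq_iff[OF bij_betw_imp_inj_on[OF bij] color[OF that] m(1)] m(2) by auto
    then show ?thesis
      using m(1) by (intro bexI[of _ m] Collect_cong conj_cong) simp_all
  qed
  obtain m n where "m \<in> {1..k}" "n \<in> {1..k}"
    "{w \<in> neighbors G v. (s + c w) mod k + 1 = i} = {w \<in> neighbors G v. c w = m}"
    "{w \<in> neighbors G v. (s + c w) mod k + 1 = j} = {w \<in> neighbors G v. c w = n}"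
    using color_class[OF ij(1)] color_class[OF ij(2)] by blast
  moreover have "card {w \<in> neighbors G v. c w = m} = card {w \<in> neighbors G v. c w = n}"
    using c v \<open>m \<in> {1..k}\<close> \<open>n \<in> {1..k}\<close>
    unfolding neighborhood_balanced_coloring_def by blast
  ultimately show ?thesis
    by simp
qed

lemma neighbors_cartesian_product:
  assumes "pair_graph G" "pair_graph H" "u \<in> pverts G" "v \<in> pverts H"
  shows "neighbors (cartesian_product G H) (u, v) =
         Pair u ` neighbors H v \<union> (\<lambda>u'. (u', v)) ` neighbors G u"
proof -
  interpret G: pair_graph G by fact
  interpret H: pair_graph H by fact
  show ?thesis
    using assms(3,4)
    by (auto simp: neighbors_def cartesian_product_def dest: G.in_arcsD2 H.in_arcsD2)
qed

text \<open>
  The two families of neighbors are disjoint since no vertex of \<open>H\<close> is its own neighbor; this is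
  why the counts add.
\<close>

lemma card_neighbors_cartesian_product:
  assumes "pair_graph G" "pair_graph H" "u \<in> pverts G" "v \<in> pverts H"
  shows "card {w \<in> neighbors (cartesian_product G H) (u, v). P w} =
         card {v' \<in> neighbors H v. P (u, v')} + card {u' \<in> neighbors G u. P (u', v)}"
proof -
  interpret G: pair_graph G by fact
  interpret H: pair_graph H by fact
  let ?A = "{v' \<in> neighbors H v. P (u, v')}" and ?B = "{u' \<in> neighbors G u. P (u', v)}"
  have split: "{w \<in> neighbors (cartesian_product G H) (u, v). P w} =
      Pair u ` ?A \<union> (\<lambda>u'. (u', v)) ` ?B"
    using neighbors_cartesian_product[OF assms] by auto
  have "finite (neighbors G u)" "finite (neighbors H v)"
    unfolding neighbors_def
    by (auto intro: finite_subset[OF _ G.pair_finite_verts] finite_subset[OF _ H.pair_finite_verts]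
        dest: G.in_arcsD2 H.in_arcsD2)
  then have fin: "finite ?A" "finite ?B"
    by auto
  have "Pair u ` ?A \<inter> (\<lambda>u'. (u', v)) ` ?B = {}"
    using H.no_loops' by (auto simp: neighbors_def)
  then show ?thesis
    unfolding split using fin by (simp add: card_Un_disjoint card_image inj_on_def)
qed

theorem theorem3p4:
  fixes G :: "'a pair_pre_digraph" and H :: "'b pair_pre_digraph" and k :: nat
  assumes "k \<ge> 2"
    and "pair_graph G" and "pair_graph H"
    and "admits_neighborhood_balanced_coloring k G"
    and "admits_neighborhood_balanced_coloring k H"
  shows "admits_neighborhood_balanced_coloring k (cartesian_product G H)"
proof -
  obtain a b where a: "neighborhood_balanced_coloring k G a"
    and b: "neighborhood_balanced_coloring k H b"
    using assms(4,5) by (auto simp: admits_neighborhood_balanced_coloring_def)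
  have k: "k > 0"
    using assms(1) by simp
  (* The added 1 moves the residues 0, ..., k - 1 to the colors 1, ..., k. *)
  define c where "c = (\<lambda>(u, v). (a u + b v) mod k + 1)"
  have "neighborhood_balanced_coloring k (cartesian_product G H) c"
    unfolding neighborhood_balanced_coloring_def
  proof (intro conjI ballI)
    show "c ` pverts (cartesian_product G H) \<subseteq> {1..k}"
      using k by (auto simp: c_def Suc_le_eq)
  next
    fix x i j
    assume x: "x \<in> pverts (cartesian_product G H)" and ij: "i \<in> {1..k}" "j \<in> {1..k}"
    obtain u v where uv: "x = (u, v)" "u \<in> pverts G" "v \<in> pverts H"
      using x by (auto simp: cartesian_product_def)
    have "card {v' \<in> neighbors H v. c (u, v') = i} = card {v' \<in> neighbors H v. c (u, v') = j}"
      using balanced_neighbors_translated_coloring[OF assms(3) b k uv(3) ij, of "a u"]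
      by (simp add: c_def)
    moreover have
      "card {u' \<in> neighbors G u. c (u', v) = i} = card {u' \<in> neighbors G u. c (u', v) = j}"
      using balanced_neighbors_translated_coloring[OF assms(2) a k uv(2) ij, of "b v"]
      by (simp add: c_def add.commute)
    ultimately show "card {w \<in> neighbors (cartesian_product G H) x. c w = i} =
                     card {w \<in> neighbors (cartesian_product G H) x. c w = j}"
      using uv by (simp add: card_neighbors_cartesian_product[OF assms(2,3)])
  qed
  then show ?thesis
    by (auto simp: admits_neighborhood_balanced_coloring_def)
qed

end
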